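(* Let $q=p^s$ with $p$ an odd prime and $s\ge1$, let $n\geq 1$, let $a_1,\dots,a_n\in\mathbb{F}_q^*$ and $b\in\mathbb{F}_q^*$, and let $$N^*(n,b)=\#\{(x_1,\dots,x_n)\in(\mathbb{F}_q^* )^n\mid a_1x_1^2+\cdots+a_nx_n^2=b\}.$$ Let $\chi$ be the quadratic character of $\mathbb{F}_q^*$ and $m=\#\{1\le i\le n\mid \chi(a_i)=\chi(b)\}$. (1) If either $p\equiv1\pmod4$, or $p\equiv3\pmod4$ and $s$ is even, then $$N^*(n,b)=\frac{(q-1)^n}{q}-\frac{(-1)^n}{2q}\Big[(1-\sqrt q)^{m+1}(1+\sqrt q)^{n-m}+(1+\sqrt q)^{m+1}(1-\sqrt q)^{n-m}\Big].$$ (2) If $p\equiv3\pmod4$ and $s$ is odd, then $$N^*(n,b)=\frac{(q-1)^n}{q}-\frac{(-1)^n}{2q}\Big[(1-\sqrt q i)^{m}(1+\sqrt q i)^{n-m+1}+(1+\sqrt q i)^{m}(1-\sqrt q i)^{n-m+1}\Big],$$ where $i=\sqrt{-1}$. *)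

theory Defs
  imports Complex_Main "HOL-Library.FuncSet" "HOL-Library.Cardinality" "HOL-Number_Theory.Cong"
begin

text \<open>The quadratic character of a finite field of odd characteristic. Only its values on nonzero
  elements matter; the value 0 at 0 is the usual convention.\<close>

definition quad_char :: "'a::{field,finite} \<Rightarrow> int" where
  "quad_char x = (if x = 0 then 0 else if \<exists>y. x = y\<^sup>2 then 1 else - 1)"

text \<open>The extensional function space makes each tuple \<open>(x\<^sub>1, \<dots>, x\<^sub>n)\<close> of nonzero elements
  correspond to exactly one function, so that the cardinality is that of the set of tuples.\<close>

definition N_star :: "nat \<Rightarrow> (nat \<Rightarrow> 'a::{field,finite}) \<Rightarrow> 'a \<Rightarrow> nat" where
  "N_star n a b = card {x \<in> {1..n} \<rightarrow>\<^sub>E (UNIV - {0}). (\<Sum>i=1..n. a i * (x i)\<^sup>2) = b}"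

end

theory Submission imports Defs begin

text \<open>
  Under convolution of functions on \<open>\<F>\<^sub>q\<close>, the quadratic character satisfies
  \<open>\<chi> * \<chi> = \<chi>(-1) (q \<delta> - 1)\<close>, where \<open>\<delta>\<close> is the indicator of 0. Hence, for any \<open>G\<close> with
  \<open>G\<^sup>2 = \<chi>(-1) q\<close>, the functions \<open>1/q\<close> and \<open>(\<delta> - 1/q \<plusminus> \<chi>/G)/2\<close> are orthogonal idempotents with
  sum \<open>\<delta>\<close>. The number of \<open>x \<noteq> 0\<close> with \<open>a x\<^sup>2 = t\<close>, as a function of \<open>t\<close>, is
  \<open>1 - \<delta> + \<chi>(a) \<chi>\<close>, which has the eigenvalues \<open>q - 1\<close> and \<open>-1 \<plusminus> \<chi>(a) G\<close> on them, so the
  convolution of \<open>n\<close> such functions is obtained by multiplying eigenvalues.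
\<close>

section \<open>Square roots in a finite field of odd order\<close>

text \<open>Pairs \<open>{x, f x}\<close> are removed one at a time. This serves both to exclude
  characteristic 2 and to determine \<open>quad_char (- 1)\<close>.\<close>

lemma even_card_if_fixed_point_free_involution:
  assumes "finite A" "\<And>x. x \<in> A \<Longrightarrow> f x \<in> A" "\<And>x. x \<in> A \<Longrightarrow> f (f x) = x"
    "\<And>x. x \<in> A \<Longrightarrow> f x \<noteq> x"
  shows "even (card A)"
  using assms
proof (induction A rule: finite_psubset_induct)
  case (psubset A)
  show ?case
  proof (cases "A = {}")
    case False
    then obtain x where x: "x \<in> A" by blast
    have fx: "f x \<in> A" "f x \<noteq> x" using x psubset.prems by auto
    let ?B = "A - {x, f x}"
    have "even (card ?B)"
    proof (rule psubset.IH)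
      show "f y \<in> ?B" if "y \<in> ?B" for y
        using that x psubset.prems(1,2) by (metis Diff_iff insert_iff empty_iff)
    qed (use x psubset.prems in auto)
    moreover have "card A = card ?B + 2"
      using x fx psubset.hyps card_mono[of A "{x, f x}"] by (simp add: card_Diff_subset)
    ultimately show ?thesis by simp
  qed simp
qed

lemma two_neq_zero_if_odd_card:
  assumes "odd CARD('a::{field,finite})"
  shows "(2::'a) \<noteq> 0"
proof
  assume "(2::'a) = 0"
  \<comment> \<open>In characteristic 2, translation by 1 is an involution without fixed
    points.\<close>
  then have "even (card (UNIV :: 'a set))"
    by (intro even_card_if_fixed_point_free_involution[where f = "\<lambda>x. x + 1"])
      (auto simp: add.assoc)
  with assms show False by simp
qed

text \<open>The roots \<open>y\<close> and \<open>- y\<close> of a nonzero square are distinct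
  because 2 is nonzero. The convention \<open>quad_char 0 = 0\<close> makes the formula cover the
  single root of 0.\<close>

lemma card_square_roots:
  fixes t :: "'a::{field,finite}"
  assumes "odd CARD('a)"
  shows "int (card {x. x\<^sup>2 = t}) = 1 + quad_char t"
proof -
  consider "t = 0" | y where "t \<noteq> 0" "t = y\<^sup>2" | "t \<noteq> 0" "\<nexists>y. t = y\<^sup>2" by blast
  then show ?thesis
  proof cases
    case 1
    then have "{x. x\<^sup>2 = t} = {0}" by auto
    with 1 show ?thesis by (simp add: quad_char_def)
  next
    case (2 y)
    then have "y \<noteq> - y"
      using two_neq_zero_if_odd_card[OF assms]
      by (metis add_self_div_2 eq_neg_iff_add_eq_0 mult_2 mult_eq_0_iff zero_power2)
    moreover have "{x. x\<^sup>2 = t} = {y, - y}" using 2 by (auto simp: power2_eq_iff)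
    ultimately show ?thesis using 2 by (auto simp: quad_char_def)
  next
    case 3
    then have "{x. x\<^sup>2 = t} = {}" by auto
    with 3 show ?thesis by (simp add: quad_char_def)
  qed
qed

lemma sum_over_squares:
  fixes g :: "'a::{field,finite} \<Rightarrow> int"
  assumes "odd CARD('a)"
  shows "(\<Sum>x\<in>UNIV. g (x\<^sup>2)) = (\<Sum>t\<in>UNIV. (1 + quad_char t) * g t)"
proof -
  have "(\<Sum>x\<in>UNIV. g (x\<^sup>2)) = (\<Sum>t\<in>UNIV. \<Sum>x | x \<in> UNIV \<and> x\<^sup>2 = t. g (x\<^sup>2))"
    by (rule sum.group[symmetric]) auto
  also have "\<dots> = (\<Sum>t\<in>UNIV. int (card {x. x\<^sup>2 = t}) * g t)"
    by (intro sum.cong) auto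
  finally show ?thesis by (simp add: card_square_roots[OF assms])
qed

section \<open>Multiplicativity of the quadratic character and its value at -1\<close>

lemma sum_quad_char:
  assumes "odd CARD('a::{field,finite})"
  shows "(\<Sum>t\<in>UNIV. quad_char (t::'a)) = 0"
  using sum_over_squares[OF assms, of "\<lambda>_. 1"] by (simp add: sum.distrib)

lemma quad_char_square_mult:
  fixes x y :: "'a::{field,finite}"
  assumes "y \<noteq> 0"
  shows "quad_char (y\<^sup>2 * x) = quad_char x"
proof -
  have "(\<exists>z. y\<^sup>2 * x = z\<^sup>2) \<longleftrightarrow> (\<exists>z. x = z\<^sup>2)"
  proof
    assume "\<exists>z. y\<^sup>2 * x = z\<^sup>2"
    then obtain z where "y\<^sup>2 * x = z\<^sup>2" ..
    then have "x = (z / y)\<^sup>2" using assms by (simp add: field_simps)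
    then show "\<exists>z. x = z\<^sup>2" ..
  qed (metis power_mult_distrib)
  then show ?thesis using assms by (simp add: quad_char_def)
qed

lemma quad_char_values:
  "x \<noteq> 0 \<Longrightarrow> quad_char x = 1 \<or> quad_char x = - 1"
  by (simp add: quad_char_def)

lemma quad_char_0 [simp]: "quad_char 0 = 0"
  by (simp add: quad_char_def)

lemma quad_char_1 [simp]: "quad_char 1 = 1"
  by (auto simp: quad_char_def intro: exI[of _ 1])

text \<open>For a nonsquare \<open>u\<close>, all terms of the vanishing sum of \<open>\<chi>(u t) + \<chi>(t)\<close> over \<open>t\<close> are
  nonpositive, hence zero.\<close>

lemma quad_char_mult:
  fixes u v :: "'a::{field,finite}"
  assumes "odd CARD('a)"
  shows "quad_char (u * v) = quad_char u * quad_char v"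
proof (cases "u = 0 \<or> quad_char u = 1")
  case True
  then consider "u = 0" | y where "y \<noteq> 0" "u = y\<^sup>2"
    by (auto simp: quad_char_def split: if_splits)
  then show ?thesis
  proof cases
    case (2 y)
    then show ?thesis
      using quad_char_square_mult[of y v] quad_char_square_mult[of y 1] by simp
  qed simp
next
  case False
  then have u: "u \<noteq> 0" "quad_char u = - 1" using quad_char_values by auto
  \<comment> \<open>For a nonzero square \<open>t\<close> the terms are -1 and 1; for a nonsquare
    the second term is -1 and the first is at most 1.\<close>
  have nonpos: "quad_char (u * t) + quad_char t \<le> 0" for t
  proof (cases "quad_char t = 1")
    case True
    then obtain y where "t = y\<^sup>2" "y \<noteq> 0"
      by (auto simp: quad_char_def split: if_splits)
    then show ?thesis
      using quad_char_square_mult[of y u] u by (simp add: quad_char_def mult.commute)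
  next
    case False
    then show ?thesis
      using quad_char_values[of t] quad_char_values[of "u * t"] u by (cases "t = 0") auto
  qed
  have "(\<Sum>t\<in>UNIV. quad_char (u * t)) = (\<Sum>t\<in>UNIV. quad_char (t::'a))"
    by (rule sum.reindex_bij_witness[of _ "\<lambda>t. t / u" "\<lambda>t. u * t"]) (use u in auto)
  then have "(\<Sum>t\<in>UNIV. - (quad_char (u * t) + quad_char t)) = 0"
    by (simp add: sum.distrib sum_negf sum_subtractf sum_quad_char[OF assms])
  then have "quad_char (u * v) + quad_char v = 0"
    using nonpos sum_nonneg_eq_0_iff[of UNIV "\<lambda>t. - (quad_char (u * t) + quad_char t)"]
    by (metis UNIV_I finite neg_0_le_iff_le neg_equal_0_iff_equal)
  then show ?thesis using u by simp
qed

lemma quad_char_sq: "x \<noteq> 0 \<Longrightarrow> quad_char x * quad_char x = 1"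
  by (simp add: quad_char_def)

text \<open>The number \<open>(q - 1)/2\<close> of nonzero squares is even if \<open>-1\<close> is a square, by the involution
  \<open>x \<mapsto> -x\<close>; otherwise it is odd, as \<open>x \<mapsto> 1/x\<close> fixes only 1.\<close>

lemma quad_char_uminus_one:
  assumes "odd CARD('a::{field,finite})"
  shows "quad_char (- 1 :: 'a) = (if CARD('a) mod 4 = 1 then 1 else - 1)"
proof -
  let ?S = "{x::'a. quad_char x = 1}"
  have S: "x \<noteq> 0" if "x \<in> ?S" for x using that by auto
  \<comment> \<open>The summand vanishes at nonsquares and is 2 at nonzero squares. Since the
    character sums to 0, this gives q - 1 = 2 \<open>card ?S\<close>.\<close>
  have "(\<Sum>t\<in>UNIV - {0}. 1 + quad_char (t::'a)) = (\<Sum>t\<in>?S. 2)"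
    by (rule sum.mono_neutral_cong_right) (use quad_char_values S in fastforce)+
  moreover have "(\<Sum>t\<in>UNIV - {0}. quad_char (t::'a)) = 0"
    using sum_quad_char[OF assms] by (simp add: sum_diff1)
  moreover have "CARD('a) \<ge> 1" by (simp add: Suc_leI)
  ultimately have cardS: "CARD('a) = 2 * card ?S + 1"
    by (simp add: sum.distrib card_Diff_subset)
  have "even (card ?S) \<longleftrightarrow> quad_char (- 1 :: 'a) = 1"
  proof (cases "quad_char (- 1 :: 'a) = 1")
    case True
    have "even (card ?S)"
    proof (rule even_card_if_fixed_point_free_involution[where f = uminus])
      show "- x \<in> ?S" if "x \<in> ?S" for x
        using that True quad_char_mult[OF assms, of "- 1" x] by simp
      show "- x \<noteq> x" if "x \<in> ?S" for x
        using S[OF that] two_neq_zero_if_odd_card[OF assms]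
        by (metis add.inverse_inverse eq_neg_iff_add_eq_0 mult_2 mult_eq_0_iff)
    qed auto
    with True show ?thesis by simp
  next
    case False
    have "even (card (?S - {1}))"
    proof (rule even_card_if_fixed_point_free_involution[where f = inverse])
      fix x assume x: "x \<in> ?S - {1}"
      then have "x \<noteq> 0" by auto
      then have "quad_char (inverse x) = 1"
        using x quad_char_mult[OF assms, of "inverse x" x] by simp
      then show "inverse x \<in> ?S - {1}" using x by auto
      show "inverse x \<noteq> x"
      proof
        assume "inverse x = x"
        then have "x\<^sup>2 = 1" using \<open>x \<noteq> 0\<close> by (metis power2_eq_square right_inverse)
        then show False using x False by (auto simp: power2_eq_1_iff)
      qed
    qed auto
    moreover have "card ?S = Suc (card (?S - {1}))" by (rule card.remove) auto
    ultimately have "odd (card ?S)" by (metis even_Suc)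
    with False show ?thesis by simp
  qed
  moreover have "CARD('a) mod 4 = 1 \<longleftrightarrow> even (card ?S)" unfolding cardS by presburger
  ultimately show ?thesis using quad_char_values[of "- 1 :: 'a"] by auto
qed

section \<open>Character sums along one quadratic variable\<close>

text \<open>For \<open>c = 0\<close> every nonzero \<open>x\<close> contributes
  \<open>quad_char (- 1)\<close>. Otherwise \<open>x * (c - x)\<close> is \<open>x\<^sup>2\<close>
  times \<open>c / x - 1\<close>, and \<open>c / x - 1\<close> runs over everything except -1, so
  the vanishing full sum loses just the term at -1.\<close>

lemma quad_char_convolution:
  fixes c :: "'a::{field,finite}"
  assumes "odd CARD('a)"
  shows "(\<Sum>x\<in>UNIV. quad_char x * quad_char (c - x)) =
    quad_char (- 1 :: 'a) * (int CARD('a) * of_bool (c = 0) - 1)"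
proof (cases "c = 0")
  case True
  have "quad_char x * quad_char (- x) = (if x = 0 then 0 else quad_char (- 1 :: 'a))" for x :: 'a
    using quad_char_mult[OF assms, of "- 1" x] quad_char_sq[of x] by (simp add: algebra_simps)
  moreover have "CARD('a) \<ge> 1" by (simp add: Suc_leI)
  ultimately show ?thesis
    using True by (simp add: sum.If_cases Collect_neg_eq Compl_eq_Diff_UNIV card_Diff_subset of_nat_diff algebra_simps)
next
  case False
  have "(\<Sum>x\<in>UNIV. quad_char x * quad_char (c - x)) =
      (\<Sum>x\<in>UNIV - {0}. quad_char x * quad_char (c - x))"
    by (rule sum.mono_neutral_right) auto
  also have "\<dots> = (\<Sum>y\<in>UNIV - {- 1}. quad_char (y::'a))"
  proof (rule sum.reindex_bij_witness[of _ "\<lambda>y. c / (y + 1)" "\<lambda>x. c / x - 1"])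
    fix x :: 'a assume "x \<in> UNIV - {0}"
    then have "x \<noteq> 0" by simp
    then have "x * (c - x) = x\<^sup>2 * (c / x - 1)" by (simp add: power2_eq_square field_simps)
    then show "quad_char (c / x - 1) = quad_char x * quad_char (c - x)"
      using quad_char_square_mult[OF \<open>x \<noteq> 0\<close>] quad_char_mult[OF assms, of x "c - x"] by simp
  qed (use False in \<open>auto simp: eq_neg_iff_add_eq_0\<close>)
  also have "\<dots> = - quad_char (- 1 :: 'a)"
    using sum_quad_char[OF assms] by (simp add: sum_diff1)
  finally show ?thesis using False by simp
qed

text \<open>Grouping by \<open>t = x\<^sup>2\<close> with weight \<open>1 + quad_char t\<close>
  splits the full sum into a plain character sum, which vanishes, and a self-convolution, from which
  the substitution of \<open>a * t\<close> extracts \<open>quad_char a\<close>. Omitting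
  \<open>x = 0\<close> subtracts \<open>quad_char b\<close>.\<close>

lemma sum_quad_char_diff_square:
  fixes a b :: "'a::{field,finite}"
  assumes "odd CARD('a)" "a \<noteq> 0"
  shows "(\<Sum>x\<in>UNIV - {0}. quad_char (b - a * x\<^sup>2)) =
    quad_char a * (quad_char (- 1 :: 'a) * (int CARD('a) * of_bool (b = 0) - 1)) - quad_char b"
proof -
  have reindex: "(\<Sum>t\<in>UNIV. g (a * t)) = (\<Sum>t\<in>UNIV. g t)" for g :: "'a \<Rightarrow> int"
    by (rule sum.reindex_bij_witness[of _ "\<lambda>t. t / a" "\<lambda>t. a * t"]) (use assms in auto)
  have "(\<Sum>t\<in>UNIV. quad_char (b - a * t)) = (\<Sum>t\<in>UNIV. quad_char (b - t))"
    by (rule reindex)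
  also have "\<dots> = (\<Sum>t\<in>UNIV. quad_char (t::'a))"
    by (rule sum.reindex_bij_witness[of _ "\<lambda>t. b - t" "\<lambda>t. b - t"]) auto
  finally have lin: "(\<Sum>t\<in>UNIV. quad_char (b - a * t)) = 0"
    using sum_quad_char[OF assms(1)] by simp
  have "quad_char t = quad_char a * quad_char (a * t)" for t
    using quad_char_mult[OF assms(1), of a t] quad_char_sq[OF assms(2)]
    by (simp flip: mult.assoc)
  then have "(\<Sum>t\<in>UNIV. quad_char t * quad_char (b - a * t)) =
      quad_char a * (\<Sum>t\<in>UNIV. quad_char (a * t) * quad_char (b - a * t))"
    unfolding sum_distrib_left by (intro sum.cong) (metis mult.assoc)+
  also have "\<dots> = quad_char a * (\<Sum>t\<in>UNIV. quad_char t * quad_char (b - t))"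
    using reindex[of "\<lambda>t. quad_char t * quad_char (b - t)"] by simp
  also have "\<dots> = quad_char a * (quad_char (- 1 :: 'a) * (int CARD('a) * of_bool (b = 0) - 1))"
    by (simp only: quad_char_convolution[OF assms(1)])
  finally show ?thesis
    using lin sum_over_squares[OF assms(1), of "\<lambda>t. quad_char (b - a * t)"]
    by (simp add: sum_diff1 distrib_right sum.distrib)
qed

text \<open>The solutions are the square roots of \<open>b / a\<close>, and
  \<open>quad_char (b / a)\<close> is the product because \<open>quad_char a\<close> is its own
  inverse. The excluded \<open>x = 0\<close> is a solution exactly when
  \<open>b = 0\<close>.\<close>

lemma card_scaled_square_roots:
  fixes a b :: "'a::{field,finite}"
  assumes "odd CARD('a)" "a \<noteq> 0"
  shows "(\<Sum>x\<in>UNIV - {0}. of_bool (b - a * x\<^sup>2 = 0)) =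
    (1 + quad_char a * quad_char b - of_bool (b = 0) :: int)"
proof -
  have "b - a * x\<^sup>2 = 0 \<longleftrightarrow> x\<^sup>2 = b / a" for x
    using assms(2) by (auto simp: field_simps)
  then have "(\<Sum>x\<in>UNIV. of_bool (b - a * x\<^sup>2 = 0)) = 1 + quad_char (b / a)"
    using card_square_roots[OF assms(1), of "b / a"] by (simp add: of_bool_def sum.If_cases)
  also have "quad_char (b / a) = quad_char a * quad_char b"
    using quad_char_mult[OF assms(1), of "b / a" a] quad_char_sq[OF assms(2)] assms(2)
    by (metis mult.assoc mult.commute mult.right_neutral nonzero_eq_divide_eq)
  finally show ?thesis using assms(2) by (subst sum_diff1) (simp_all only: finite, simp)
qed

section \<open>Recursion on the number of variables and its diagonalization\<close>

text \<open>The last coordinate \<open>y\<close> is split off: each tuple is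
  \<open>g(Suc n := y)\<close> for a unique \<open>y\<close> and a unique extensional
  \<open>g\<close> on \<open>{1..n}\<close>. This is the convolution by one more factor.\<close>

lemma N_star_Suc:
  fixes a :: "nat \<Rightarrow> 'a::{field,finite}"
  shows "N_star (Suc n) a b = (\<Sum>y\<in>UNIV - {0}. N_star n a (b - a (Suc n) * y\<^sup>2))"
proof -
  define S where "S c = {x \<in> {1..n} \<rightarrow>\<^sub>E (UNIV - {0}). (\<Sum>i=1..n. a i * (x i)\<^sup>2) = c}" for c
  let ?T = "SIGMA y : UNIV - {0}. S (b - a (Suc n) * y\<^sup>2)"
  let ?f = "\<lambda>(y, g). g(Suc n := y)"
  have I: "{1..Suc n} = insert (Suc n) {1..n}" by auto
  have upd: "(\<Sum>i=1..n. a i * ((g(Suc n := y)) i)\<^sup>2) = (\<Sum>i=1..n. a i * (g i)\<^sup>2)" for g y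
    by (intro sum.cong) auto
  have "{x \<in> {1..Suc n} \<rightarrow>\<^sub>E (UNIV - {0}). (\<Sum>i=1..Suc n. a i * (x i)\<^sup>2) = b} = ?f ` ?T"
    unfolding I PiE_insert_eq S_def
    by (auto simp: image_iff upd algebra_simps simp del: fun_upd_apply) (auto simp: algebra_simps)
  moreover have "inj_on ?f ?T"
    by (rule inj_on_subset[OF inj_combinator[of "Suc n" "{1..n}" "\<lambda>_. UNIV - {0}"]])
      (auto simp: S_def)
  moreover have "finite (S c)" for c
    unfolding S_def
    by (rule finite_subset[OF _ finite_PiE[of "{1..n}" "\<lambda>_. UNIV - {0}"]]) auto
  ultimately have "N_star (Suc n) a b = (\<Sum>y\<in>UNIV - {0}. card (S (b - a (Suc n) * y\<^sup>2)))"
    unfolding N_star_def by (simp add: card_image)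
  then show ?thesis by (simp add: S_def N_star_def)
qed

text \<open>At \<open>n = 0\<close> the three idempotents add up to the indicator of 0; each
  induction step multiplies them by their eigenvalues. The target \<open>b\<close> must range over
  the whole field, 0 included, since the recursion evaluates at shifted targets.\<close>

lemma N_star_eq:
  fixes a :: "nat \<Rightarrow> 'a::{field,finite}" and G :: complex
  defines "q \<equiv> of_nat CARD('a)"
  assumes odd: "odd CARD('a)"
    and G: "G\<^sup>2 = of_int (quad_char (- 1 :: 'a)) * q"
    and a: "\<And>i. i \<in> {1..n} \<Longrightarrow> a i \<noteq> 0"
  shows "of_nat (N_star n a b) = (q - 1) ^ n / q
    + (\<Prod>i=1..n. - 1 + of_int (quad_char (a i)) * G)
        * (of_bool (b = 0) - 1 / q + of_int (quad_char b) / G) / 2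
    + (\<Prod>i=1..n. - 1 - of_int (quad_char (a i)) * G)
        * (of_bool (b = 0) - 1 / q - of_int (quad_char b) / G) / 2"
  using a
proof (induction n arbitrary: b)
  case 0
  show ?case by (auto simp: N_star_def q_def field_simps)
next
  case (Suc n)
  let ?\<alpha> = "a (Suc n)"
  define P where "P = (\<Prod>i=1..n. - 1 + of_int (quad_char (a i)) * G)"
  define Q where "Q = (\<Prod>i=1..n. - 1 - of_int (quad_char (a i)) * G)"
  define \<chi>a where "\<chi>a = (of_int (quad_char ?\<alpha>) :: complex)"
  define \<chi>b where "\<chi>b = (of_int (quad_char b) :: complex)"
  define \<delta> where "\<delta> = (of_bool (b = 0) :: complex)"
  define \<epsilon> where "\<epsilon> = (of_int (quad_char (- 1 :: 'a)) :: complex)"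
  have \<alpha>: "?\<alpha> \<noteq> 0" using Suc.prems by simp
  have q0: "q \<noteq> 0" by (simp add: q_def)
  have \<epsilon>: "\<epsilon> * \<epsilon> = 1"
    using arg_cong[OF quad_char_sq[of "- 1 :: 'a"], of "of_int :: int \<Rightarrow> complex"]
    by (simp add: \<epsilon>_def)
  have G0: "G \<noteq> 0" using G q0 \<epsilon> by (auto simp: \<epsilon>_def)
  have G2: "G * G = \<epsilon> * q" using G by (simp add: \<epsilon>_def power2_eq_square)
  have card: "(\<Sum>y::'a\<in>UNIV - {0}. (1::complex)) = q - 1"
    by (simp add: q_def card_Diff_subset of_nat_diff Suc_leI)
  have s\<delta>: "(\<Sum>y\<in>UNIV - {0}. of_bool (b - ?\<alpha> * y\<^sup>2 = 0)) = 1 + \<chi>a * \<chi>b - \<delta>"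
    using arg_cong[OF card_scaled_square_roots[OF odd \<alpha>, of b], of "of_int :: int \<Rightarrow> complex"]
    by (simp add: \<chi>a_def \<chi>b_def \<delta>_def)
  have s\<chi>: "(\<Sum>y\<in>UNIV - {0}. of_int (quad_char (b - ?\<alpha> * y\<^sup>2))) =
      \<chi>a * (\<epsilon> * (q * \<delta> - 1)) - \<chi>b"
    using arg_cong[OF sum_quad_char_diff_square[OF odd \<alpha>, of b], of "of_int :: int \<Rightarrow> complex"]
    by (simp add: \<chi>a_def \<chi>b_def \<delta>_def \<epsilon>_def q_def)
  have IH: "of_nat (N_star n a c) = (q - 1) ^ n / q
      + P * (of_bool (c = 0) - 1 / q + of_int (quad_char c) / G) / 2
      + Q * (of_bool (c = 0) - 1 / q - of_int (quad_char c) / G) / 2" for c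
    unfolding P_def Q_def by (rule Suc.IH) (use Suc.prems in auto)
  \<comment> \<open>Regrouping by 1, the indicator and the character leaves exactly the three sums
    over \<open>y\<close> computed in \<open>card\<close>, \<open>s\<delta>\<close> and
    \<open>s\<chi>\<close>.\<close>
  have alg: "R / q + P * (d - 1 / q + x / G) / 2 + Q * (d - 1 / q - x / G) / 2 =
      (R / q - P / q / 2 - Q / q / 2) * 1 + (P + Q) / 2 * d + (P - Q) / 2 / G * x" for R d x
    by (simp add: algebra_simps add_divide_distrib diff_divide_distrib)
  have "of_nat (N_star (Suc n) a b) =
      (\<Sum>y\<in>UNIV - {0}. of_nat (N_star n a (b - ?\<alpha> * y\<^sup>2)))"
    by (simp add: N_star_Suc)
  also have "\<dots> = (\<Sum>y\<in>UNIV - {0}. ((q - 1) ^ n / q - P / q / 2 - Q / q / 2) * 1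
      + (P + Q) / 2 * of_bool (b - ?\<alpha> * y\<^sup>2 = 0)
      + (P - Q) / 2 / G * of_int (quad_char (b - ?\<alpha> * y\<^sup>2)))"
    unfolding IH alg ..
  also have "\<dots> = ((q - 1) ^ n / q - P / q / 2 - Q / q / 2) * (q - 1)
      + (P + Q) / 2 * (1 + \<chi>a * \<chi>b - \<delta>)
      + (P - Q) / 2 / G * (\<chi>a * (\<epsilon> * (q * \<delta> - 1)) - \<chi>b)"
    unfolding sum.distrib sum_distrib_left[symmetric] card s\<delta> s\<chi> ..
  also have "\<dots> = (q - 1) ^ Suc n / q
      + P * (- 1 + \<chi>a * G) * (\<delta> - 1 / q + \<chi>b / G) / 2
      + Q * (- 1 - \<chi>a * G) * (\<delta> - 1 / q - \<chi>b / G) / 2"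
  proof -
    \<comment> \<open>The relation G^2 = \<epsilon> q turns the convolution term into a multiple of
      \<delta> - 1/q, so that the idempotents reappear.\<close>
    have "\<epsilon> * (q * \<delta> - 1) = G * G * (\<delta> - 1 / q)"
      unfolding G2 using q0 by (simp add: field_simps)
    then have "\<epsilon> * (q * \<delta> - 1) / G = G * (\<delta> - 1 / q)"
      using G0 by simp
    then have t1: "(P - Q) / 2 / G * (\<chi>a * (\<epsilon> * (q * \<delta> - 1)) - \<chi>b) =
       (P - Q) / 2 * (\<chi>a * (G * (\<delta> - 1 / q)) - \<chi>b / G)"
      by (metis (no_types, lifting) diff_divide_distrib times_divide_eq_left times_divide_eq_right)
    have t2: "P * (- 1 + \<chi>a * G) * (\<delta> - 1 / q + \<chi>b / G) =
       P * (- \<delta> + 1 / q - \<chi>b / G + \<chi>a * (G * (\<delta> - 1 / q)) + \<chi>a * \<chi>b)"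
      using G0 by (simp add: algebra_simps)
    have t3: "Q * (- 1 - \<chi>a * G) * (\<delta> - 1 / q - \<chi>b / G) =
       Q * (- \<delta> + 1 / q + \<chi>b / G - \<chi>a * (G * (\<delta> - 1 / q)) + \<chi>a * \<chi>b)"
      using G0 by (simp add: algebra_simps)
    have t4: "((q - 1) ^ n / q - P / q / 2 - Q / q / 2) * (q - 1)
      = (q - 1) ^ Suc n / q - (P + Q) / 2 * (1 - 1 / q)"
      using q0 by (simp add: field_simps)
    \<comment> \<open>Here \<open>u\<close> is \<open>1 / q\<close>, \<open>v\<close> is
      \<open>\<chi>a * (G * (\<delta> - 1 / q))\<close> and \<open>w\<close> is
      \<open>\<chi>b / G\<close>; the remaining identity no longer involves \<open>q\<close> or
      \<open>G\<close>.\<close>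
    have "r - (P + Q) / 2 * (1 - u) + (P + Q) / 2 * (1 + \<chi>a * \<chi>b - \<delta>) + (P - Q) / 2 * (v - w) =
        r + P * (- \<delta> + u - w + v + \<chi>a * \<chi>b) / 2 + Q * (- \<delta> + u + w - v + \<chi>a * \<chi>b) / 2"
      for r u v w
      by (simp add: field_simps)
    then show ?thesis unfolding t1 t2 t3 t4 .
  qed
  finally show ?case
    by (simp add: P_def Q_def \<chi>a_def \<chi>b_def \<delta>_def mult.commute)
qed

section \<open>Closed form for nonzero b and the two cases\<close>

lemma N_star_eq_powers:
  fixes a :: "nat \<Rightarrow> 'a::{field,finite}" and G :: complex
  defines "q \<equiv> of_nat CARD('a)" and "\<epsilon> \<equiv> of_int (quad_char (- 1 :: 'a))"
  assumes odd: "odd CARD('a)"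
    and G: "G\<^sup>2 = \<epsilon> * q"
    and a: "\<And>i. i \<in> {1..n} \<Longrightarrow> a i \<noteq> 0" and b: "b \<noteq> 0"
    and m: "m = card {i \<in> {1..n}. quad_char (a i) = quad_char b}"
  shows "of_nat (N_star n a b) = (q - 1) ^ n / q - (- 1) ^ n / (2 * q) *
    ((1 - G) ^ m * (1 + G) ^ (n - m) * (1 - \<epsilon> * G)
     + (1 + G) ^ m * (1 - G) ^ (n - m) * (1 + \<epsilon> * G))"
proof -
  define c where "c = (of_int (quad_char b) :: complex)"
  have c: "c * c = 1"
    using arg_cong[OF quad_char_sq[OF b], of "of_int :: int \<Rightarrow> complex"] by (simp add: c_def)
  have q0: "q \<noteq> 0" by (simp add: q_def)
  have \<epsilon>: "\<epsilon> * \<epsilon> = 1"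
    using arg_cong[OF quad_char_sq[of "- 1 :: 'a"], of "of_int :: int \<Rightarrow> complex"]
    by (simp add: \<epsilon>_def)
  have G0: "G \<noteq> 0" using G q0 \<epsilon> by auto
  \<comment> \<open>All character values are 1 or -1, so \<open>quad_char (a i) * c\<close> is 1 for
    the \<open>m\<close> indices with equal characters and -1 for the others. \<open>H\<close> will
    be \<open>G\<close> and \<open>- G\<close>.\<close>
  have prod: "(\<Prod>i=1..n. - 1 + of_int (quad_char (a i)) * (c * H)) =
      (- 1) ^ n * ((1 - H) ^ m * (1 + H) ^ (n - m))" for H :: complex
  proof -
    let ?A = "{i \<in> {1..n}. quad_char (a i) = quad_char b}"
    have "(\<Prod>i=1..n. - 1 + of_int (quad_char (a i)) * (c * H)) =
        (\<Prod>i=1..n. (- 1) * (if quad_char (a i) = quad_char b then 1 - H else 1 + H))"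
    proof (rule prod.cong[OF refl])
      fix i assume "i \<in> {1..n}"
      then show "- 1 + of_int (quad_char (a i)) * (c * H) =
          (- 1) * (if quad_char (a i) = quad_char b then 1 - H else 1 + H)"
        using quad_char_values[OF a[of i]] quad_char_values[OF b] by (auto simp: c_def)
    qed
    also have "\<dots> = (- 1) ^ n * (\<Prod>i=1..n. if quad_char (a i) = quad_char b then 1 - H else 1 + H)"
      by (simp only: prod.distrib) simp
    also have "(\<Prod>i=1..n. if quad_char (a i) = quad_char b then 1 - H else 1 + H) =
        (1 - H) ^ m * (1 + H) ^ card ({1..n} - ?A)"
      by (simp add: prod.If_cases m Int_def set_diff_eq cong: conj_cong)
    also have "card ({1..n} - ?A) = n - m" by (subst card_Diff_subset) (auto simp: m)
    finally show ?thesis .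
  qed
  \<comment> \<open>This rewrites 1/G as \<epsilon> G / q, which puts the idempotent values over the
    common denominator q.\<close>
  have "\<epsilon> * G * G = \<epsilon> * \<epsilon> * q" using G by (simp add: power2_eq_square)
  moreover have "c \<noteq> 0" using c by auto
  ultimately have "c / (c * G) = \<epsilon> * G / q"
    using G0 q0 \<epsilon> by (simp add: frac_eq_eq)
  \<comment> \<open>Replacing \<open>G\<close> by \<open>\<chi>(b) G\<close> treats both values of \<open>\<chi>(b)\<close> at once.\<close>
  moreover have "(c * G)\<^sup>2 = \<epsilon> * q"
    using c G by (simp only: power_mult_distrib power2_eq_square[of c]) simp
  ultimately have "of_nat (N_star n a b) = (q - 1) ^ n / q
    + (- 1) ^ n * ((1 - G) ^ m * (1 + G) ^ (n - m)) * (- 1 / q + \<epsilon> * G / q) / 2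
    + (- 1) ^ n * ((1 + G) ^ m * (1 - G) ^ (n - m)) * (- 1 / q - \<epsilon> * G / q) / 2"
    using N_star_eq[OF odd, of "c * G" n a b] prod[of G] prod[of "- G"] a b
    by (simp add: q_def \<epsilon>_def c_def)
  moreover have "r + z * X * (- 1 / q + g / q) / 2 + z * Y * (- 1 / q - g / q) / 2 =
      r - z / (2 * q) * (X * (1 - g) + Y * (1 + g))" for r z X Y g
    using q0 by (simp add: field_simps)
  ultimately show ?thesis by simp
qed

theorem theorem3p3:
  fixes p s q n m :: nat
    and a :: "nat \<Rightarrow> 'a::{field,finite}" and b :: 'a
  assumes "prime p" and "odd p" and "s \<ge> 1"
    and "q = p ^ s" and "CARD('a) = q"
    and "n \<ge> 1"
    and "\<And>i. i \<in> {1..n} \<Longrightarrow> a i \<noteq> 0" and "b \<noteq> 0"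
    and "m = card {i \<in> {1..n}. quad_char (a i) = quad_char b}"
  shows
    "([p = 1] (mod 4) \<or> ([p = 3] (mod 4) \<and> even s) \<longrightarrow>
        real (N_star n a b) =
          (real q - 1) ^ n / real q
          - (- 1) ^ n / (2 * real q) *
            ((1 - sqrt (real q)) ^ (m + 1) * (1 + sqrt (real q)) ^ (n - m)
             + (1 + sqrt (real q)) ^ (m + 1) * (1 - sqrt (real q)) ^ (n - m)))
     \<and>
     ([p = 3] (mod 4) \<and> odd s \<longrightarrow>
        (of_nat (N_star n a b) :: complex) =
          (of_nat q - 1) ^ n / of_nat q
          - (- 1) ^ n / (2 * of_nat q) *
            ((1 - complex_of_real (sqrt (real q)) * \<i>) ^ m
               * (1 + complex_of_real (sqrt (real q)) * \<i>) ^ (n - m + 1)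
             + (1 + complex_of_real (sqrt (real q)) * \<i>) ^ m
               * (1 - complex_of_real (sqrt (real q)) * \<i>) ^ (n - m + 1)))"
proof -
  have odd: "odd CARD('a)" using assms by simp
  have sq: "(complex_of_real (sqrt (real q)))\<^sup>2 = of_nat q"
    by (simp flip: of_real_power)
  note formula = N_star_eq_powers[OF odd _ assms(7,8,9), unfolded assms(5)]
  show ?thesis
  proof (intro conjI impI)
    assume case1: "[p = 1] (mod 4) \<or> ([p = 3] (mod 4) \<and> even s)"
    have "[q = 1] (mod 4)"
    proof (cases "[p = 1] (mod 4)")
      case True
      then show ?thesis using cong_pow[of p 1 4 s] assms(4) by simp
    next
      case False
      with case1 obtain k where "s = 2 * k" "[p = 3] (mod 4)" by (auto elim: evenE)
      then have "[p\<^sup>2 = 1] (mod 4)" using cong_pow[of p 3 4 2] by (simp add: cong_def)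
      then show ?thesis
        using cong_pow[of "p\<^sup>2" 1 4 k] \<open>s = 2 * k\<close> assms(4) by (simp add: power_mult)
    qed
    then have "quad_char (- 1 :: 'a) = 1"
      using quad_char_uminus_one[OF odd] assms(5) by (simp add: cong_def)
    \<comment> \<open>With \<epsilon> = 1 and G the square root of q, the factors 1 - \<epsilon> G
      and 1 + \<epsilon> G raise the exponent \<open>m\<close> to \<open>m + 1\<close>. All terms
      are real, so the complex identity descends.\<close>
    then have "complex_of_real (real (N_star n a b)) = complex_of_real
        ((real q - 1) ^ n / real q - (- 1) ^ n / (2 * real q) *
            ((1 - sqrt (real q)) ^ (m + 1) * (1 + sqrt (real q)) ^ (n - m)
             + (1 + sqrt (real q)) ^ (m + 1) * (1 - sqrt (real q)) ^ (n - m)))"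
      using formula[of "complex_of_real (sqrt (real q))"] sq by (simp add: mult_ac)
    then show "real (N_star n a b) = (real q - 1) ^ n / real q - (- 1) ^ n / (2 * real q) *
            ((1 - sqrt (real q)) ^ (m + 1) * (1 + sqrt (real q)) ^ (n - m)
             + (1 + sqrt (real q)) ^ (m + 1) * (1 - sqrt (real q)) ^ (n - m))"
      by (simp only: of_real_eq_iff)
  next
    assume case2: "[p = 3] (mod 4) \<and> odd s"
    then obtain k where k: "s = 2 * k + 1" by (auto elim: oddE)
    have "[p\<^sup>2 = 1] (mod 4)" using case2 cong_pow[of p 3 4 2] by (simp add: cong_def)
    then have "[(p\<^sup>2) ^ k * p = 1 * 3] (mod 4)"
      using cong_pow[of "p\<^sup>2" 1 4 k] case2 by (intro cong_mult) simp_all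
    then have "q mod 4 = 3"
      using assms(4) k by (simp add: cong_def mult.commute flip: power_mult)
    then have "quad_char (- 1 :: 'a) = - 1"
      using quad_char_uminus_one[OF odd] assms(5) by simp
    \<comment> \<open>Now \<epsilon> = -1 and G is \<open>\<i>\<close> times the square root of q.
      Then 1 - \<epsilon> G = 1 + G, so the extra factor joins the power \<open>n - m\<close>
      instead.\<close>
    then show "(of_nat (N_star n a b) :: complex) =
          (of_nat q - 1) ^ n / of_nat q
          - (- 1) ^ n / (2 * of_nat q) *
            ((1 - complex_of_real (sqrt (real q)) * \<i>) ^ m
               * (1 + complex_of_real (sqrt (real q)) * \<i>) ^ (n - m + 1)
             + (1 + complex_of_real (sqrt (real q)) * \<i>) ^ m
               * (1 - complex_of_real (sqrt (real q)) * \<i>) ^ (n - m + 1))"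
      using formula[of "complex_of_real (sqrt (real q)) * \<i>"] sq
      by (simp add: power_mult_distrib mult_ac)
  qed
qed

end
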